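(* Let $m, k, n$ be positive integers and let $G = K_m \vee C_{2k+1}$. Then $AT(G \square P_n) = m+3$. Consequently, $(K_m \vee C_{2k+1}) \square P_n$ is chromatic-choosable, i.e. its chromatic number equals its list chromatic number.
   Context: All graphs are finite and simple, and digraphs are simple. $K_m$ is the complete graph on $m$ vertices, $C_{2k+1}$ the cycle on $2k+1$ vertices, $P_n$ the path on $n$ vertices. The join $G_1 \vee G_2$ of vertex-disjoint graphs consists of $G_1$, $G_2$ and all edges between a vertex of $G_1$ and a vertex of $G_2$. The Cartesian product $G \square H$ has vertex set $V(G)\times V(H)$, with $(u,v)$ adjacent to $(u',v')$ iff either $u=u'$ and $vv'\in E(H)$, or $v=v'$ and $uu'\in E(G)$. A circulation contained in a digraph $D$ is a spanning subdigraph $E$ of $D$ such that $d^-_E(v)=d^+_E(v)$ (indegree equals outdegree in $E$) for every $v\in V(D)$; it is even (resp. odd) if it has an even (resp. odd) number of edges (the edgeless circulation is even). The Alon-Tarsi number $AT(G)$ is the smallest $k$ for which there is an orientation $D$ of $G$ with maximum indegree $k-1$ such that the number of even circulations and the number of odd circulations contained in $D$ are different. The list chromatic number $\chi_\ell(G)$ is the smallest $k$ such that for every assignment $L$ of lists of colors to the vertices with $|L(v)|\ge k$ for all $v$, there is a proper coloring $f$ of $G$ with $f(v)\in L(v)$ for all $v$. A graph $G$ is chromatic-choosable if $\chi(G)=\chi_\ell(G)$, where $\chi(G)$ is the chromatic number. *)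

theory Defs
  imports "Graph_Theory.Graph_Theory"
begin

text \<open>
  As in the imported graph library, an undirected simple graph is a symmetric loop-free
  digraph without parallel arcs (locale \<^locale>\<open>pair_graph\<close>): an edge \<open>uv\<close> is represented by
  the two arcs \<open>(u, v)\<close> and \<open>(v, u)\<close>.
\<close>

section \<open>Graph families and operations\<close>

definition complete_graph :: "nat \<Rightarrow> nat pair_pre_digraph" where
  "complete_graph m = \<lparr> pverts = {..<m}, parcs = {(u, v). u < m \<and> v < m \<and> u \<noteq> v} \<rparr>"

text \<open>A cycle only for length at least 3; length 2 gives a single edge and length 1 a loop.\<close>

definition cycle_graph :: "nat \<Rightarrow> nat pair_pre_digraph" where
  "cycle_graph l = \<lparr> pverts = {..<l},
     parcs = {(u, v). u < l \<and> v < l \<and> (v = Suc u mod l \<or> u = Suc v mod l)} \<rparr>"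

definition path_graph :: "nat \<Rightarrow> nat pair_pre_digraph" where
  "path_graph n = \<lparr> pverts = {..<n},
     parcs = {(u, v). u < n \<and> v < n \<and> (v = Suc u \<or> u = Suc v)} \<rparr>"

text \<open>The sum type makes the two vertex sets disjoint.\<close>

definition graph_join :: "'a pair_pre_digraph \<Rightarrow> 'b pair_pre_digraph \<Rightarrow> ('a + 'b) pair_pre_digraph"
where
  "graph_join G H = \<lparr> pverts = pverts G <+> pverts H,
     parcs = {(Inl u, Inl v) |u v. (u, v) \<in> parcs G}
           \<union> {(Inr u, Inr v) |u v. (u, v) \<in> parcs H}
           \<union> {(Inl u, Inr v) |u v. u \<in> pverts G \<and> v \<in> pverts H}
           \<union> {(Inr v, Inl u) |u v. u \<in> pverts G \<and> v \<in> pverts H} \<rparr>"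

definition cartesian_product ::
  "'a pair_pre_digraph \<Rightarrow> 'b pair_pre_digraph \<Rightarrow> ('a \<times> 'b) pair_pre_digraph" where
  "cartesian_product G H = \<lparr> pverts = pverts G \<times> pverts H,
     parcs = {((u, v), (u', v')) |u v u' v'.
                u \<in> pverts G \<and> u = u' \<and> (v, v') \<in> parcs H
              \<or> v \<in> pverts H \<and> v = v' \<and> (u, u') \<in> parcs G} \<rparr>"

lemma complete_digraph_complete_graph: "complete_digraph m (with_proj (complete_graph m))"
  by (auto simp: complete_digraph_pair_def complete_graph_def)

lemma pair_graphI:
  assumes "finite (pverts G)"
    and "\<And>u v. (u, v) \<in> parcs G \<Longrightarrow> u \<in> pverts G \<and> v \<in> pverts G \<and> u \<noteq> v \<and> (v, u) \<in> parcs G"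
  shows "pair_graph G"
proof -
  have "parcs G \<subseteq> pverts G \<times> pverts G"
    using assms(2) by auto
  then have "finite (parcs G)"
    using assms(1) by (meson finite_SigmaI finite_subset)
  then show ?thesis
    using assms by unfold_locales (auto simp: symmetric_def sym_def)
qed

lemma pair_graphD:
  assumes "pair_graph G" "(u, v) \<in> parcs G"
  shows "u \<in> pverts G" "v \<in> pverts G" "u \<noteq> v" "(v, u) \<in> parcs G"
proof -
  interpret pair_graph G by fact
  show "u \<in> pverts G" "v \<in> pverts G" "u \<noteq> v" "(v, u) \<in> parcs G"
    using assms(2) by (auto intro: arcs_symmetric dest: in_arcsD1 in_arcsD2 no_loops')
qed

lemma pair_graph_irrefl: "pair_graph G \<Longrightarrow> (u, u) \<notin> parcs G"
  using pair_graphD(3) by fast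

lemma pair_graph_finite_verts: "pair_graph G \<Longrightarrow> finite (pverts G)"
  by (simp add: pair_digraph.axioms(1) pair_fin_digraph.pair_finite_verts pair_graph.axioms(1))

lemma pair_graph_complete_graph: "pair_graph (complete_graph m)"
  by (rule pair_graphI) (auto simp: complete_graph_def)

lemma pair_graph_path_graph: "pair_graph (path_graph n)"
  by (rule pair_graphI) (auto simp: path_graph_def)

lemma pair_graph_cycle_graph:
  assumes "l \<ge> 3"
  shows "pair_graph (cycle_graph l)"
  using assms by (intro pair_graphI) (auto simp: cycle_graph_def mod_Suc)

lemma pair_graph_graph_join:
  assumes "pair_graph G" "pair_graph H"
  shows "pair_graph (graph_join G H)"
  using pair_graphD[OF assms(1)] pair_graphD[OF assms(2)]
    pair_graph_irrefl[OF assms(1)] pair_graph_irrefl[OF assms(2)]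
    pair_graph_finite_verts[OF assms(1)] pair_graph_finite_verts[OF assms(2)]
  by (intro pair_graphI) (auto simp: graph_join_def)

lemma pair_graph_cartesian_product:
  assumes "pair_graph G" "pair_graph H"
  shows "pair_graph (cartesian_product G H)"
  using pair_graphD[OF assms(1)] pair_graphD[OF assms(2)]
    pair_graph_irrefl[OF assms(1)] pair_graph_irrefl[OF assms(2)]
    pair_graph_finite_verts[OF assms(1)] pair_graph_finite_verts[OF assms(2)]
  by (intro pair_graphI) (auto simp: cartesian_product_def)

section \<open>Alon-Tarsi number\<close>

definition orientation :: "'a pair_pre_digraph \<Rightarrow> 'a pair_pre_digraph \<Rightarrow> bool" where
  "orientation D G \<longleftrightarrow> pverts D = pverts G \<and> parcs D \<subseteq> parcs G
     \<and> (\<forall>(u, v) \<in> parcs G. (u, v) \<in> parcs D \<longleftrightarrow> (v, u) \<notin> parcs D)"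

definition circulation :: "'a pair_pre_digraph \<Rightarrow> 'a pair_pre_digraph \<Rightarrow> bool" where
  "circulation E D \<longleftrightarrow> spanning (with_proj E) (with_proj D)
     \<and> (\<forall>v \<in> pverts D. in_degree (with_proj E) v = out_degree (with_proj E) v)"

definition even_circulations :: "'a pair_pre_digraph \<Rightarrow> 'a pair_pre_digraph set" where
  "even_circulations D = {E. circulation E D \<and> even (card (parcs E))}"

definition odd_circulations :: "'a pair_pre_digraph \<Rightarrow> 'a pair_pre_digraph set" where
  "odd_circulations D = {E. circulation E D \<and> odd (card (parcs E))}"

text \<open>Meaningful for digraphs with at least one vertex.\<close>

definition max_in_degree :: "'a pair_pre_digraph \<Rightarrow> nat" where
  "max_in_degree D = Max (in_degree (with_proj D) ` pverts D)"

text \<open>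
  The condition \<open>max_in_degree D + 1 = k\<close> says that the maximum indegree is \<open>k - 1\<close>, without
  truncated subtraction at \<open>k = 0\<close>.
\<close>

definition alon_tarsi_number :: "'a pair_pre_digraph \<Rightarrow> nat" where
  "alon_tarsi_number G = (LEAST k. \<exists>D. orientation D G \<and> max_in_degree D + 1 = k
     \<and> card (even_circulations D) \<noteq> card (odd_circulations D))"

section \<open>Colourings\<close>

definition proper_coloring :: "'a pair_pre_digraph \<Rightarrow> ('a \<Rightarrow> 'c) \<Rightarrow> bool" where
  "proper_coloring G f \<longleftrightarrow> (\<forall>(u, v) \<in> parcs G. f u \<noteq> f v)"

definition chromatic_number :: "'a pair_pre_digraph \<Rightarrow> nat" where
  "chromatic_number G = (LEAST k. \<exists>f :: 'a \<Rightarrow> nat.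
     proper_coloring G f \<and> f ` pverts G \<subseteq> {..<k})"

text \<open>
  Colours are natural numbers, which is no restriction: the finite lists on a finite graph
  involve only finitely many colours. Finiteness is explicit because \<^const>\<open>card\<close> is 0 on
  infinite sets.
\<close>

definition list_chromatic_number :: "'a pair_pre_digraph \<Rightarrow> nat" where
  "list_chromatic_number G = (LEAST k. \<forall>L :: 'a \<Rightarrow> nat set.
     (\<forall>v \<in> pverts G. finite (L v) \<and> k \<le> card (L v)) \<longrightarrow>
     (\<exists>f. proper_coloring G f \<and> (\<forall>v \<in> pverts G. f v \<in> L v)))"

definition chromatic_choosable :: "'a pair_pre_digraph \<Rightarrow> bool" where
  "chromatic_choosable G \<longleftrightarrow> chromatic_number G = list_chromatic_number G"

end

theory Submission
  imports Defs "HOL-Library.FuncSet"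
begin

text \<open>
  Since \<open>\<chi> \<le> \<chi>\<^sub>\<ell> \<le> AT\<close> (the second inequality is the Alon-Tarsi theorem) and \<open>K\<^sub>m\<close> together
  with an odd cycle needs \<open>m + 3\<close> colours, it suffices to orient the graph with indegrees at most
  \<open>m + 2\<close> and an odd number of circulations. All edges between the clique copies and the cycle
  copies are oriented towards the cycles and the clique copies are oriented acyclically; no
  circulation uses these arcs, so only \<open>C\<^sub>L \<box> P\<^sub>n\<close> with indegrees at most 2 matters.

  The circulations of an orientation correspond to the subsets of a reference orientation with a
  prescribed excess (outdegree minus indegree). On the cylinder \<open>C\<^sub>L \<box> P\<^sub>n\<close>, let \<open>w\<^sub>n(j)\<close> be the
  number of flows that carry one unit from each vertex of the bottom ring except \<open>0\<close> to each
  vertex of the top ring except \<open>j\<close>. Exactly one rung between two consecutive rings is unused, and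
  a ring has two flows moving the gap from \<open>i\<close> to \<open>j\<close> if \<open>i = j\<close> and one otherwise, so modulo 2
  \<open>w\<^sub>n\<^sub>+\<^sub>1(j)\<close> is the sum of \<open>w\<^sub>n(i)\<close> over \<open>i \<noteq> j\<close>. As \<open>L\<close> is odd, \<open>w\<^sub>n(j)\<close> is odd exactly for \<open>j \<noteq> 0\<close>.
\<close>

section \<open>Flows in arc sets\<close>

definition excess :: "('a \<times> 'a) set \<Rightarrow> 'a \<Rightarrow> int" where
  "excess S v = (\<Sum>e\<in>S. of_bool (fst e = v) - of_bool (snd e = v))"

definition flows :: "('a \<times> 'a) set \<Rightarrow> ('a \<Rightarrow> int) \<Rightarrow> ('a \<times> 'a) set set" where
  "flows A d = {S. S \<subseteq> A \<and> excess S = d}"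

definition indeg :: "('a \<times> 'a) set \<Rightarrow> 'a \<Rightarrow> nat" where
  "indeg A v = card {e \<in> A. snd e = v}"

definition outdeg :: "('a \<times> 'a) set \<Rightarrow> 'a \<Rightarrow> nat" where
  "outdeg A v = card {e \<in> A. fst e = v}"

lemma finite_flows: "finite A \<Longrightarrow> finite (flows A d)"
  by (rule finite_subset[of _ "Pow A"]) (auto simp: flows_def)

lemma excess_Un:
  "finite S \<Longrightarrow> finite T \<Longrightarrow> S \<inter> T = {} \<Longrightarrow> excess (S \<union> T) v = excess S v + excess T v"
  by (simp add: excess_def sum.union_disjoint)

lemma excess_eq_0: "v \<notin> fst ` S \<Longrightarrow> v \<notin> snd ` S \<Longrightarrow> excess S v = 0"
  unfolding excess_def by (rule sum.neutral) force

lemma excess_image_inj: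
  assumes "inj f"
  shows "excess (map_prod f f ` S) (f v) = excess S v"
proof -
  have "inj_on (map_prod f f) S"
    using assms by (meson inj_on_subset prod.inj_map subset_UNIV)
  then show ?thesis
    unfolding excess_def using assms by (simp add: sum.reindex inj_eq)
qed

lemma excess_converse: "excess (prod.swap ` S) v = - excess S v"
  unfolding excess_def by (simp add: sum.reindex sum_negf[symmetric])

lemma excess_eq_outdeg_indeg:
  assumes "finite S"
  shows "excess S v = int (outdeg S v) - int (indeg S v)"
  using assms by (simp add: excess_def outdeg_def indeg_def sum_subtractf sum_of_bool_eq Int_def)

text \<open>Summation by parts: an arc meets only the terms of its two ends. With constant
  \<open>r\<close> it says that the total excess is zero.\<close>

lemma sum_weighted_excess:
  fixes r :: "'a \<Rightarrow> int"
  assumes "finite V" "S \<subseteq> V \<times> V"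
  shows "(\<Sum>v\<in>V. r v * excess S v) = (\<Sum>e\<in>S. r (fst e) - r (snd e))"
proof -
  have "(\<Sum>v\<in>V. r v * excess S v)
      = (\<Sum>e\<in>S. \<Sum>v\<in>V. r v * (of_bool (fst e = v) - of_bool (snd e = v)))"
    unfolding excess_def sum_distrib_left by (rule sum.swap)
  also have "\<dots> = (\<Sum>e\<in>S. r (fst e) - r (snd e))"
  proof (rule sum.cong[OF refl])
    fix e assume "e \<in> S"
    then have "fst e \<in> V" "snd e \<in> V" using assms(2) by auto
    then show "(\<Sum>v\<in>V. r v * (of_bool (fst e = v) - of_bool (snd e = v))) = r (fst e) - r (snd e)"
      using assms(1) by (simp add: right_diff_distrib sum_subtractf of_bool_def
          if_distrib[of "\<lambda>x. _ * x"] cong: if_cong)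
  qed
  finally show ?thesis .
qed

text \<open>With \<open>r\<close> as a potential, \<open>sum_weighted_excess\<close> makes the total
  rise along the arcs of a circulation zero. Every single rise is nonnegative, hence zero, which
  excludes the arcs of \<open>B\<close>.\<close>

lemma flows_zero_confined:
  fixes r :: "'a \<Rightarrow> int"
  assumes "finite (A \<union> B)"
    and "\<And>u v. (u, v) \<in> A \<Longrightarrow> r u \<le> r v" "\<And>u v. (u, v) \<in> B \<Longrightarrow> r u < r v"
  shows "flows (A \<union> B) (\<lambda>_. 0) = flows A (\<lambda>_. 0)"
proof -
  have "S \<subseteq> A" if "S \<in> flows (A \<union> B) (\<lambda>_. 0)" for S
  proof
    fix e assume e: "e \<in> S"
    have S: "S \<subseteq> A \<union> B" "excess S = (\<lambda>_. 0)"
      using that by (auto simp: flows_def)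
    have fin: "finite S"
      using S(1) assms(1) finite_subset by auto
    define V where "V = fst ` S \<union> snd ` S"
    have "finite V" "S \<subseteq> V \<times> V"
      using fin by (force simp: V_def)+
    then have "(\<Sum>e\<in>S. r (snd e) - r (fst e)) = 0"
      using sum_weighted_excess[of V S r] S(2) by (simp add: sum_subtractf)
    moreover have le: "0 \<le> r (snd e) - r (fst e)" if "e \<in> S" for e
    proof -
      have "(fst e, snd e) \<in> A \<or> (fst e, snd e) \<in> B" using that S(1) by auto
      then show ?thesis using assms(2,3)[of "fst e" "snd e"] by linarith
    qed
    ultimately have "r (snd e) - r (fst e) = 0"
      using sum_nonneg_eq_0_iff[OF fin, of "\<lambda>e. r (snd e) - r (fst e)"] e by auto
    then show "e \<in> A"
      using e S(1) assms(3)[of "fst e" "snd e"] by (cases e) auto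
  qed
  then show ?thesis
    by (auto simp: flows_def)
qed

text \<open>
  Reversing the arcs of \<open>T\<close> turns a flow \<open>S\<close> of the same excess into the circulation formed
  by the arcs on which \<open>S\<close> and \<open>T\<close> differ.
\<close>

lemma card_flows_reverse:
  assumes "finite A" "A \<inter> prod.swap ` A = {}" "T \<in> flows A d"
  shows "card (flows ((A - T) \<union> prod.swap ` T) (\<lambda>_. 0)) = card (flows A d)"
proof -
  let ?sw = "prod.swap :: 'a \<times> 'a \<Rightarrow> _"
  have T: "T \<subseteq> A" "excess T = d" using assms(3) by (auto simp: flows_def)
  have fin: "finite S" if "S \<subseteq> A" for S using that assms(1) finite_subset by auto
  have sw: "x \<notin> A" if "?sw x \<in> T" for x
  proof
    assume "x \<in> A"
    then have "?sw x \<in> A \<inter> ?sw ` A" using that T(1) by blast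
    then show False using assms(2) by blast
  qed
  have exc: "excess ((S - T) \<union> ?sw ` (T - S)) v = excess S v - excess T v" if "S \<subseteq> A" for S v
  proof -
    have "excess ((S - T) \<union> ?sw ` (T - S)) v = excess (S - T) v - excess (T - S) v"
      by (subst excess_Un) (use that fin[OF that] fin[OF T(1)] sw in \<open>auto simp: excess_converse\<close>)
    moreover have "excess ((S - T) \<union> (S \<inter> T)) v = excess (S - T) v + excess (S \<inter> T) v"
      by (rule excess_Un) (use fin[OF that] in auto)
    moreover have "excess ((T - S) \<union> (S \<inter> T)) v = excess (T - S) v + excess (S \<inter> T) v"
      by (rule excess_Un) (use fin[OF T(1)] in auto)
    moreover have "(S - T) \<union> (S \<inter> T) = S" "(T - S) \<union> (S \<inter> T) = T" by auto
    ultimately show ?thesis by simp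
  qed
  \<comment> \<open>To recover \<open>S\<close> from \<open>E\<close>: outside \<open>T\<close> it
    agrees with \<open>E\<close>, and an arc of \<open>T\<close> lies in \<open>S\<close> iff its
    reversal is missing from \<open>E\<close>.\<close>
  have "bij_betw (\<lambda>S. (S - T) \<union> ?sw ` (T - S)) (flows A d) (flows ((A - T) \<union> ?sw ` T) (\<lambda>_. 0))"
  proof (rule bij_betw_byWitness[where f' = "\<lambda>E. (E \<inter> A) \<union> (T - ?sw ` E)"])
    have "((S - T) \<union> ?sw ` (T - S)) \<inter> A \<union> (T - ?sw ` ((S - T) \<union> ?sw ` (T - S))) = S"
      if "S \<subseteq> A" for S
    proof -
      have "((S - T) \<union> ?sw ` (T - S)) \<inter> A = S - T"
        using that sw by auto
      moreover have "?sw ` ((S - T) \<union> ?sw ` (T - S)) = ?sw ` (S - T) \<union> (T - S)"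
        by (simp add: image_Un image_image)
      moreover have "?sw ` (S - T) \<inter> T = {}"
        using that sw by auto
      ultimately show ?thesis by auto
    qed
    then show "\<forall>S\<in>flows A d.
      ((S - T) \<union> ?sw ` (T - S)) \<inter> A \<union> (T - ?sw ` ((S - T) \<union> ?sw ` (T - S))) = S"
      by (simp add: flows_def)
    have inv: "((E \<inter> A) \<union> (T - ?sw ` E)) - T \<union> ?sw ` (T - ((E \<inter> A) \<union> (T - ?sw ` E))) = E"
      if "E \<subseteq> (A - T) \<union> ?sw ` T" for E
    proof -
      have "E \<inter> T = {}" using that sw T(1) by force
      then have "(E \<inter> A \<union> (T - ?sw ` E)) - T = E \<inter> A"
        "T - ((E \<inter> A) \<union> (T - ?sw ` E)) = T \<inter> ?sw ` E" by auto
      moreover have "?sw ` (T \<inter> ?sw ` E) = E - A"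
        using that sw by (force simp: image_iff)
      ultimately show ?thesis by auto
    qed
    show "\<forall>E\<in>flows ((A - T) \<union> ?sw ` T) (\<lambda>_. 0).
      ((E \<inter> A) \<union> (T - ?sw ` E)) - T \<union> ?sw ` (T - ((E \<inter> A) \<union> (T - ?sw ` E))) = E"
      using inv by (simp add: flows_def)
    show "(\<lambda>S. (S - T) \<union> ?sw ` (T - S)) ` flows A d \<subseteq> flows ((A - T) \<union> ?sw ` T) (\<lambda>_. 0)"
      using exc T(2) by (auto simp: flows_def fun_eq_iff)
    show "(\<lambda>E. (E \<inter> A) \<union> (T - ?sw ` E)) ` flows ((A - T) \<union> ?sw ` T) (\<lambda>_. 0) \<subseteq> flows A d"
    proof safe
      fix E assume E: "E \<in> flows ((A - T) \<union> ?sw ` T) (\<lambda>_. 0)"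
      have sub: "(E \<inter> A) \<union> (T - ?sw ` E) \<subseteq> A" using T(1) by auto
      have "excess E v = excess ((E \<inter> A) \<union> (T - ?sw ` E)) v - excess T v" for v
        using exc[OF sub, of v] inv[of E] E by (simp add: flows_def)
      then show "(E \<inter> A) \<union> (T - ?sw ` E) \<in> flows A d"
        using E sub T(2) by (auto simp: flows_def fun_eq_iff)
    qed
  qed
  then show ?thesis by (rule bij_betw_same_card[symmetric])
qed

section \<open>Coefficient extraction on a grid of colours\<close>

text \<open>These are divided-difference weights: summing the weighted values of a polynomial of
  degree at most \<open>d\<close> over \<open>L\<close> yields its coefficient of degree
  \<open>d\<close>. The induction adds one node \<open>e\<close>.\<close>

lemma ex_leading_coefficient_weights:
  fixes L :: "real set"
  assumes "finite L" "card L = Suc d"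
  shows "\<exists>w. \<forall>i\<le>d. (\<Sum>c\<in>L. w c * c ^ i) = of_bool (i = d)"
  using assms
proof (induction d arbitrary: L)
  case 0
  then obtain c where "L = {c}" by (auto simp: card_1_singleton_iff)
  then show ?case by (auto intro: exI[of _ "\<lambda>_. 1"])
next
  case (Suc d)
  obtain e L' where L: "L = insert e L'" "e \<notin> L'" "card L' = Suc d" "finite L'"
    using Suc.prems by (metis card_Suc_eq finite_insert)
  obtain w where w: "\<And>i. i \<le> d \<Longrightarrow> (\<Sum>c\<in>L'. w c * c ^ i) = of_bool (i = d)"
    using Suc.IH L by blast
  \<comment> \<open>The weight at \<open>e\<close> makes all weights sum to zero, so
    \<open>c ^ i\<close> may be replaced by \<open>c ^ i - e ^ i\<close>. Dividing by
    \<open>c - e\<close> leaves a polynomial of lower degree in \<open>c\<close>, to which the old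
    weights apply.\<close>
  define w' where
    "w' c = (if c = e then - (\<Sum>c\<in>L'. w c / (c - e)) else w c / (c - e))" for c
  have "(\<Sum>c\<in>L. w' c * c ^ i) = of_bool (i = Suc d)" if i: "i \<le> Suc d" for i
  proof -
    have "(\<Sum>c\<in>L'. w' c * c ^ i) = (\<Sum>c\<in>L'. w c / (c - e) * c ^ i)"
      using L(2) by (intro sum.cong) (auto simp: w'_def)
    then have "(\<Sum>c\<in>L. w' c * c ^ i) = (\<Sum>c\<in>L'. w c / (c - e) * (c ^ i - e ^ i))"
      using L by (simp add: w'_def sum_distrib_right sum_subtractf right_diff_distrib)
    also have "\<dots> = (\<Sum>c\<in>L'. w c * (\<Sum>j<i. e ^ (i - Suc j) * c ^ j))"
    proof (rule sum.cong[OF refl])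
      fix c assume "c \<in> L'"
      then have "c - e \<noteq> 0" using L(2) by auto
      then show "w c / (c - e) * (c ^ i - e ^ i) = w c * (\<Sum>j<i. e ^ (i - Suc j) * c ^ j)"
        by (simp add: power_diff_sumr2)
    qed
    also have "\<dots> = (\<Sum>j<i. e ^ (i - Suc j) * (\<Sum>c\<in>L'. w c * c ^ j))"
      unfolding sum_distrib_left by (subst sum.swap) (simp add: mult_ac)
    also have "\<dots> = (\<Sum>j<i. e ^ (i - Suc j) * of_bool (j = d))"
      using i by (intro sum.cong) (auto simp: w)
    also have "\<dots> = of_bool (i = Suc d)"
      using i by (cases "i = Suc d") auto
    finally show ?thesis .
  qed
  then show ?case by blast
qed

lemma prod_endpoint:
  fixes x :: "'a \<Rightarrow> real"
  assumes "finite T" "finite V" "g ` T \<subseteq> V"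
  shows "(\<Prod>e\<in>T. x (g e)) = (\<Prod>v\<in>V. x v ^ card {e \<in> T. g e = v})"
proof -
  have "(\<Prod>v\<in>V. x v ^ card {e \<in> T. g e = v}) = (\<Prod>v\<in>V. \<Prod>e\<in>{e \<in> T. g e = v}. x (g e))"
    by (rule prod.cong) auto
  then show ?thesis using prod.group[OF assms, of "\<lambda>e. x (g e)"] by simp
qed

text \<open>
  The signed circulation count is the coefficient of the monomial with exponents \<^term>\<open>indeg A\<close>
  in the graph polynomial; the weights extract it from the values on the grid.
\<close>

lemma ex_proper_choice:
  fixes L :: "'a \<Rightarrow> real set"
  assumes V: "finite V" "A \<subseteq> V \<times> V"
    and L: "\<And>v. v \<in> V \<Longrightarrow> finite (L v)" "\<And>v. v \<in> V \<Longrightarrow> card (L v) = Suc (indeg A v)"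
    and nz: "(\<Sum>S\<in>flows A (\<lambda>_. 0). (-1) ^ card S) \<noteq> (0::real)"
  shows "\<exists>x. (\<forall>v\<in>V. x v \<in> L v) \<and> (\<forall>(u, v)\<in>A. x u \<noteq> x v)"
proof (rule ccontr)
  assume none: "\<not> ?thesis"
  have finA: "finite A" using V by (meson finite_SigmaI finite_subset)
  have "\<forall>v\<in>V. \<exists>w. \<forall>i\<le>indeg A v. (\<Sum>c\<in>L v. w c * c ^ i) = of_bool (i = indeg A v)"
    using ex_leading_coefficient_weights L by blast
  then obtain w where w:
    "\<And>v i. v \<in> V \<Longrightarrow> i \<le> indeg A v \<Longrightarrow> (\<Sum>c\<in>L v. w v c * c ^ i) = of_bool (i = indeg A v)"
    by metis
  \<comment> \<open>In the expanded product over arcs, \<open>S\<close> collects the arcs that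
    contribute their tail. Then \<open>m S v\<close> is the exponent of \<open>x v\<close>, and it
    differs from \<open>indeg A v\<close> by the excess.\<close>
  define m where "m S v = indeg (A - S) v + outdeg S v" for S v
  have m: "int (m S v) = int (indeg A v) + excess S v" if "S \<subseteq> A" for S v
  proof -
    have fin: "finite S" using that finA finite_subset by auto
    have "{e \<in> A. snd e = v} = {e \<in> A - S. snd e = v} \<union> {e \<in> S. snd e = v}"
      using that by auto
    then have "indeg A v = indeg (A - S) v + indeg S v"
      unfolding indeg_def using finA fin by (simp add: card_Un_disjoint disjoint_iff)
    then show ?thesis by (simp add: m_def excess_eq_outdeg_indeg[OF fin])
  qed
  have expand: "(\<Prod>e\<in>A. x (snd e) - x (fst e)) = (\<Sum>S\<in>Pow A. (-1) ^ card S * (\<Prod>v\<in>V. x v ^ m S v))"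
    for x :: "'a \<Rightarrow> real"
  proof -
    have "(\<Prod>e\<in>S. x (fst e)) * (\<Prod>e\<in>A - S. x (snd e)) = (\<Prod>v\<in>V. x v ^ m S v)" if "S \<subseteq> A" for S
    proof -
      have "finite S" using that finA finite_subset by auto
      then have "(\<Prod>e\<in>S. x (fst e)) = (\<Prod>v\<in>V. x v ^ outdeg S v)"
        "(\<Prod>e\<in>A - S. x (snd e)) = (\<Prod>v\<in>V. x v ^ indeg (A - S) v)"
        using prod_endpoint[of S V fst x] prod_endpoint[of "A - S" V snd x] V that finA
        by (force simp: outdeg_def indeg_def)+
      then show ?thesis by (simp add: m_def power_add prod.distrib mult.commute)
    qed
    then show ?thesis
      using finA by (simp add: prod_diff_conv_sum mult.assoc)
  qed
  \<comment> \<open>Over the grid, the weighted sum of a monomial factorizes into one sum per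
    vertex.\<close>
  have "(\<Sum>x\<in>PiE V L. (\<Prod>v\<in>V. w v (x v)) * (\<Prod>e\<in>A. x (snd e) - x (fst e)))
      = (\<Sum>S\<in>Pow A. (-1) ^ card S * (\<Sum>x\<in>PiE V L. \<Prod>v\<in>V. w v (x v) * x v ^ m S v))"
    unfolding expand sum_distrib_left by (subst sum.swap) (simp add: prod.distrib mult_ac)
  also have "\<dots> = (\<Sum>S\<in>Pow A. (-1) ^ card S * (\<Prod>v\<in>V. \<Sum>c\<in>L v. w v c * c ^ m S v))"
    using prod_sum_PiE[of V L "\<lambda>v c. w v c * c ^ m _ v"] V(1) L(1) by simp
  also have "\<dots> = (\<Sum>S\<in>Pow A. (-1) ^ card S * of_bool (S \<in> flows A (\<lambda>_. 0)))"
  proof (rule sum.cong[OF refl])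
    fix S assume "S \<in> Pow A"
    then have S: "S \<subseteq> A" by auto
    have "(\<Prod>v\<in>V. \<Sum>c\<in>L v. w v c * c ^ m S v) = of_bool (S \<in> flows A (\<lambda>_. 0))"
    proof (cases "S \<in> flows A (\<lambda>_. 0)")
      case True
      then have "m S v = indeg A v" for v
        using m[OF S, of v] by (simp add: flows_def)
      then show ?thesis using True by (simp add: w)
    next
      case False
      then obtain u where u: "excess S u \<noteq> 0" using S by (auto simp: flows_def)
      have SV: "S \<subseteq> V \<times> V" using S V by auto
      then have uV: "u \<in> V" using u excess_eq_0[of u S] by force
      \<comment> \<open>The total excess is zero and \<open>u\<close> is unbalanced, so some excess
        is negative. At that vertex the exponent is below the indegree and the weighted sum
        vanishes, whatever happens at exponents above it, which the weights do not control.\<close>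
      have "\<exists>v\<in>V. excess S v < 0"
      proof (rule ccontr)
        assume "\<not> ?thesis"
        then have "\<And>v. v \<in> V \<Longrightarrow> 0 \<le> excess S v" by force
        then show False
          using sum_weighted_excess[OF V(1) SV, of "\<lambda>_. 1"] sum_nonneg_eq_0_iff[OF V(1), of "excess S"] u uV
          by auto
      qed
      then obtain v where v: "v \<in> V" "excess S v < 0" by auto
      then have "m S v < indeg A v" using m[OF S, of v] by simp
      then have "(\<Sum>c\<in>L v. w v c * c ^ m S v) = 0" using w[OF v(1), of "m S v"] by simp
      then show ?thesis using False v(1) V(1) by (auto intro!: prod_zero)
    qed
    then show "(-1) ^ card S * (\<Prod>v\<in>V. \<Sum>c\<in>L v. w v c * c ^ m S v)
        = (-1) ^ card S * of_bool (S \<in> flows A (\<lambda>_. 0))" by simp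
  qed
  also have "\<dots> = (\<Sum>S\<in>flows A (\<lambda>_. 0). (-1) ^ card S)"
    using finA by (intro sum.mono_neutral_cong_right) (auto simp: flows_def)
  finally have "(\<Sum>x\<in>PiE V L. (\<Prod>v\<in>V. w v (x v)) * (\<Prod>e\<in>A. x (snd e) - x (fst e))) \<noteq> 0"
    using nz by simp
  \<comment> \<open>A nonzero sum has a nonzero term; its grid point separates the ends of every
    arc.\<close>
  then obtain x where x: "x \<in> PiE V L" "(\<Prod>e\<in>A. x (snd e) - x (fst e)) \<noteq> 0"
    by (metis (no_types, lifting) mult_zero_right sum.neutral)
  then have "\<forall>e\<in>A. x (snd e) \<noteq> x (fst e)" using finA by auto
  with x(1) none show False by fastforce
qed

section \<open>Flows on the cylinder\<close>

definition ring_arcs :: "nat \<Rightarrow> nat \<Rightarrow> ((nat \<times> nat) \<times> (nat \<times> nat)) set" where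
  "ring_arcs L i = (\<lambda>p. ((p, i), (Suc p mod L, i))) ` {..<L}"

definition rung_arcs :: "nat \<Rightarrow> nat \<Rightarrow> ((nat \<times> nat) \<times> (nat \<times> nat)) set" where
  "rung_arcs L i = (\<lambda>p. ((p, i), (p, Suc i))) ` {..<L}"

text \<open>The levels run from \<open>0\<close> to \<open>n\<close>, so there are
  \<open>n + 1\<close> rings.\<close>

fun cylinder_arcs :: "nat \<Rightarrow> nat \<Rightarrow> ((nat \<times> nat) \<times> (nat \<times> nat)) set" where
  "cylinder_arcs L 0 = ring_arcs L 0"
| "cylinder_arcs L (Suc n) = cylinder_arcs L n \<union> rung_arcs L n \<union> ring_arcs L (Suc n)"

text \<open>A unit travelling from \<open>b\<close> to \<open>a\<close> in ring \<open>i\<close>: if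
  units arrive everywhere but at \<open>a\<close>, it moves the gap to \<open>b\<close>. For
  \<open>a = b\<close> the demand is zero.\<close>

definition ring_demand :: "nat \<Rightarrow> nat \<Rightarrow> nat \<Rightarrow> nat \<times> nat \<Rightarrow> int" where
  "ring_demand i a b = (\<lambda>(p, i'). of_bool (i' = i) * (of_bool (p = b) - of_bool (p = a)))"

text \<open>
  All vertices of the bottom ring but \<open>0\<close> emit a unit, all vertices of the top ring but \<open>j\<close>
  absorb one.
\<close>

definition cylinder_demand :: "nat \<Rightarrow> nat \<Rightarrow> nat \<Rightarrow> nat \<times> nat \<Rightarrow> int" where
  "cylinder_demand L n j = (\<lambda>(p, i). of_bool (p < L)
     * (of_bool (i = 0 \<and> p \<noteq> 0) - of_bool (i = n \<and> p \<noteq> j)))"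

lemma Suc_mod_inj: "p < L \<Longrightarrow> q < L \<Longrightarrow> Suc p mod L = Suc q mod L \<longleftrightarrow> p = q"
  by (auto simp: mod_Suc split: if_splits)

lemma Suc_mod_surj: "p < L \<Longrightarrow> \<exists>q<L. p = Suc q mod L"
proof (cases p)
  case 0
  assume "p < L"
  then show ?thesis using 0 by (intro exI[of _ "L - 1"]) auto
next
  case (Suc q)
  assume "p < L"
  then show ?thesis using Suc by (intro exI[of _ q]) auto
qed

lemma inj_ring: "inj_on (\<lambda>p. ((p, i), (Suc p mod L, i))) P"
  by (auto simp: inj_on_def)

lemma inj_rung: "inj_on (\<lambda>p. ((p, i), (p, Suc i))) P"
  by (auto simp: inj_on_def)

lemma finite_cylinder: "finite (ring_arcs L i)" "finite (rung_arcs L i)" "finite (cylinder_arcs L n)"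
  by (induction n) (auto simp: ring_arcs_def rung_arcs_def)

lemma cylinder_arcs_layers:
  "e \<in> cylinder_arcs L n \<Longrightarrow> fst (fst e) < L \<and> snd (fst e) \<le> n \<and> fst (snd e) < L \<and> snd (snd e) \<le> n"
  by (induction n) (auto simp: ring_arcs_def rung_arcs_def)

lemma excess_cylinder_above:
  assumes "S \<subseteq> cylinder_arcs L n" "n < i"
  shows "excess S (p, i) = 0"
proof -
  have "fst e \<noteq> (p, i) \<and> snd e \<noteq> (p, i)" if "e \<in> S" for e
    using cylinder_arcs_layers[of e L n] assms that by auto
  then show ?thesis by (intro excess_eq_0) (metis imageE)+
qed

lemma cylinder_arcs_disjoint:
  "cylinder_arcs L n \<inter> rung_arcs L n = {}" "cylinder_arcs L n \<inter> ring_arcs L (Suc n) = {}"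
  "rung_arcs L n \<inter> ring_arcs L (Suc n) = {}"
  using cylinder_arcs_layers[of _ L n] by (force simp: ring_arcs_def rung_arcs_def)+

text \<open>Writing the vertex as a successor gives its incoming ring arc the tail \<open>q\<close>
  and avoids subtraction modulo \<open>L\<close>.\<close>

lemma excess_ring:
  assumes "P \<subseteq> {..<L}" "q < L"
  shows "excess ((\<lambda>p. ((p, i), (Suc p mod L, i))) ` P) (Suc q mod L, i)
    = of_bool (Suc q mod L \<in> P) - of_bool (q \<in> P)"
proof -
  have fin: "finite P" using finite_subset[OF assms(1)] by simp
  have "excess ((\<lambda>p. ((p, i), (Suc p mod L, i))) ` P) (Suc q mod L, i)
    = (\<Sum>p\<in>P. of_bool (p = Suc q mod L) - of_bool (Suc p mod L = Suc q mod L))"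
    unfolding excess_def by (subst sum.reindex[OF inj_ring]) simp
  also have "\<dots> = (\<Sum>p\<in>P. of_bool (p = Suc q mod L) - of_bool (p = q))"
    using assms by (intro sum.cong) (auto simp: Suc_mod_inj)
  finally show ?thesis using fin by (simp add: sum_subtractf of_bool_def)
qed

lemma excess_ring_other: "T \<subseteq> ring_arcs L i \<Longrightarrow> \<not> (p < L \<and> i' = i) \<Longrightarrow> excess T (p, i') = 0"
  by (rule excess_eq_0) (auto simp: ring_arcs_def)

lemma excess_rung:
  assumes "finite W"
  shows "excess ((\<lambda>p. ((p, i), (p, Suc i))) ` W) (q, i')
    = of_bool (q \<in> W) * (of_bool (i' = i) - of_bool (i' = Suc i))"
proof -
  have "excess ((\<lambda>p. ((p, i), (p, Suc i))) ` W) (q, i')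
    = (\<Sum>p\<in>W. of_bool (p = q) * (of_bool (i' = i) - of_bool (i' = Suc i)))"
    unfolding excess_def by (subst sum.reindex[OF inj_rung]) (auto intro!: sum.cong)
  then show ?thesis using assms by (simp add: sum_distrib_right[symmetric] of_bool_def)
qed

text \<open>A set of ring arcs is encoded by the set \<open>P\<close> of its tails. The demand
  prescribes the jumps of the indicator of \<open>P\<close> between consecutive positions, so a
  single membership determines \<open>P\<close> and there are at most two solutions.\<close>

lemma ring_flow_sets:
  assumes "a < L" "b < L"
  shows "card {P. P \<subseteq> {..<L} \<and> (\<forall>q<L. of_bool (Suc q mod L \<in> P) - of_bool (q \<in> P)
      = (of_bool (Suc q mod L = b) - of_bool (Suc q mod L = a) :: int))} = (if a = b then 2 else 1)"
    (is "card ?F = _")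
proof -
  define ok where "ok P \<longleftrightarrow> P \<subseteq> {..<L} \<and> (\<forall>q<L. of_bool (Suc q mod L \<in> P) - of_bool (q \<in> P)
      = (of_bool (Suc q mod L = b) - of_bool (Suc q mod L = a) :: int))" for P
  have ok: "of_bool (Suc q mod L \<in> P) - of_bool (q \<in> P)
      = (of_bool (Suc q mod L = b) - of_bool (Suc q mod L = a) :: int)" if "ok P" "q < L" for P q
    using that unfolding ok_def by blast
  \<comment> \<open>Two solutions have equal jumps, so they agree at every position or at
    none.\<close>
  have agree: "(p \<in> P) = (p \<in> Q) \<longleftrightarrow> (0 \<in> P) = (0 \<in> Q)" if "ok P" "ok Q" "p < L" for P Q p
    using that(3)
  proof (induction p)
    case (Suc p)
    have "of_bool (Suc p \<in> P) - of_bool (p \<in> P) = (of_bool (Suc p \<in> Q) - of_bool (p \<in> Q) :: int)"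
      using ok[OF that(1), of p] ok[OF that(2), of p] Suc.prems by simp
    then have "(Suc p \<in> P) = (Suc p \<in> Q) \<longleftrightarrow> (p \<in> P) = (p \<in> Q)"
      by (auto simp: of_bool_def split: if_splits)
    then show ?case using Suc by simp
  qed simp
  have eqI: "P = Q" if "ok P" "ok Q" "p < L" "(p \<in> P) = (p \<in> Q)" for P Q p
  proof -
    have "(x \<in> P) = (x \<in> Q)" if "x < L" for x
      using agree[OF \<open>ok P\<close> \<open>ok Q\<close> that] agree[OF \<open>ok P\<close> \<open>ok Q\<close> \<open>p < L\<close>] \<open>(p \<in> P) = (p \<in> Q)\<close>
      by blast
    then show ?thesis using that(1,2) unfolding ok_def by blast
  qed
  have "card (Collect ok) = (if a = b then 2 else 1)"
  proof (cases "a = b")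
    case True
    have all: "ok {}" "ok {..<L}" using True assms(1) by (auto simp: ok_def)
    have "P = {} \<or> P = {..<L}" if "ok P" for P
      using eqI[OF that all(1) assms(1)] eqI[OF that all(2) assms(1)] assms(1) by blast
    then have "Collect ok = {{}, {..<L}}" using all by blast
    moreover have "{} \<noteq> {..<L}" using assms(1) by auto
    ultimately show ?thesis using True by simp
  next
    case False
    \<comment> \<open>The directed path from \<open>b\<close> to \<open>a\<close>: its tails run
      cyclically from \<open>b\<close> to the predecessor of \<open>a\<close>, wrapping past
      \<open>0\<close> when \<open>a < b\<close>.\<close>
    define P where "P = (if b < a then {b..<a} else {..<L} - {a..<b})"
    have P: "ok P"
      unfolding ok_def
    proof (intro conjI allI impI)
      show "P \<subseteq> {..<L}" using assms by (auto simp: P_def)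
      fix q assume "q < L"
      then consider "Suc q < L" "Suc q mod L = Suc q" | "Suc q = L" "Suc q mod L = 0"
        by (cases "Suc q = L") auto
      then show "of_bool (Suc q mod L \<in> P) - of_bool (q \<in> P)
          = (of_bool (Suc q mod L = b) - of_bool (Suc q mod L = a) :: int)"
        using assms False by cases (auto simp: P_def of_bool_def)
    qed
    obtain q where q: "q < L" "b = Suc q mod L" using Suc_mod_surj[OF assms(2)] by blast
    \<comment> \<open>The jump \<open>+1\<close> at \<open>b\<close> forces \<open>b\<close> into
      every solution, which leaves only one.\<close>
    have mem: "b \<in> R" if "ok R" for R
    proof -
      have "of_bool (b \<in> R) - of_bool (q \<in> R) = (1::int)"
        using ok[OF that q(1)] False unfolding q(2)[symmetric] by simp
      then show ?thesis by (auto simp: of_bool_def split: if_splits)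
    qed
    have "Q = P" if "ok Q" for Q
      using eqI[OF that P assms(2)] mem[OF that] mem[OF P] by blast
    then have "Collect ok = {P}" using P by blast
    then show ?thesis using False by simp
  qed
  then show ?thesis unfolding ok_def .
qed

lemma card_flows_ring:
  assumes "a < L" "b < L"
  shows "card (flows (ring_arcs L i) (ring_demand i a b)) = (if a = b then 2 else 1)"
proof -
  let ?h = "\<lambda>p. ((p, i), (Suc p mod L, i))"
  let ?F = "{P. P \<subseteq> {..<L} \<and> (\<forall>q<L. of_bool (Suc q mod L \<in> P) - of_bool (q \<in> P)
      = (of_bool (Suc q mod L = b) - of_bool (Suc q mod L = a) :: int))}"
  have iff: "excess (?h ` P) = ring_demand i a b \<longleftrightarrow> P \<in> ?F" if P: "P \<subseteq> {..<L}" for P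
  proof
    assume "excess (?h ` P) = ring_demand i a b"
    then show "P \<in> ?F" using excess_ring[OF P, of _ i] P by (simp add: ring_demand_def)
  next
    assume F: "P \<in> ?F"
    have "excess (?h ` P) (p, i') = ring_demand i a b (p, i')" for p i'
    proof (cases "p < L \<and> i' = i")
      case True
      then obtain q where "q < L" "p = Suc q mod L" using Suc_mod_surj by blast
      then show ?thesis using excess_ring[OF P, of q i] True F by (simp add: ring_demand_def)
    next
      case False
      then show ?thesis
        using excess_ring_other[of "?h ` P" L i p i'] P assms
        by (auto simp: ring_demand_def ring_arcs_def)
    qed
    then show "excess (?h ` P) = ring_demand i a b" by auto
  qed
  have "flows (ring_arcs L i) (ring_demand i a b) = (\<lambda>P. ?h ` P) ` ?F"
  proof (intro equalityI subsetI)
    fix S assume S: "S \<in> flows (ring_arcs L i) (ring_demand i a b)"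
    then have "S \<subseteq> ?h ` {..<L}" by (simp add: flows_def ring_arcs_def)
    then obtain P where P: "P \<subseteq> {..<L}" "S = ?h ` P" by (rule subset_imageE)
    with S have "P \<in> ?F" using iff[OF P(1)] by (simp add: flows_def)
    then show "S \<in> (\<lambda>P. ?h ` P) ` ?F" using P(2) by (rule rev_image_eqI)
  next
    fix S assume "S \<in> (\<lambda>P. ?h ` P) ` ?F"
    then obtain P where P: "P \<in> ?F" "S = ?h ` P" by (rule imageE)
    then have sub: "P \<subseteq> {..<L}" by blast
    then show "S \<in> flows (ring_arcs L i) (ring_demand i a b)"
      using iff[OF sub] P unfolding flows_def ring_arcs_def by blast
  qed
  moreover have "inj_on (\<lambda>P. ?h ` P) ?F"
    by (rule inj_on_image) (rule inj_ring)
  ultimately show ?thesis using ring_flow_sets[OF assms] by (simp add: card_image)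
qed

text \<open>The rungs other than \<open>x\<close> pass on what level \<open>n\<close> absorbs and
  leave the gap \<open>x\<close> at level \<open>n + 1\<close>; the ring there moves it to
  \<open>j\<close>.\<close>

lemma cylinder_demand_Suc:
  assumes "x < L" "j < L"
  shows "cylinder_demand L (Suc n) j v = cylinder_demand L n x v
    + excess ((\<lambda>p. ((p, n), (p, Suc n))) ` ({..<L} - {x})) v + ring_demand (Suc n) x j v"
  using assms by (cases v) (auto simp: cylinder_demand_def ring_demand_def excess_rung of_bool_def)

text \<open>Ring arcs have total excess zero on the top ring, so the \<open>L - 1\<close> units
  absorbed there all enter through rungs, one unit each.\<close>

lemma cylinder_rungs_missing_one:
  assumes "j < L" "S \<subseteq> cylinder_arcs L n" "W \<subseteq> {..<L}" "T \<subseteq> ring_arcs L (Suc n)"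
    and exc: "\<And>v. excess S v + excess ((\<lambda>p. ((p, n), (p, Suc n))) ` W) v + excess T v
      = cylinder_demand L (Suc n) j v"
  shows "\<exists>x<L. W = {..<L} - {x}"
proof -
  have fin: "finite W" using finite_subset[OF assms(3)] by simp
  have "excess S (p, Suc n) = 0" for p
    using excess_cylinder_above[OF assms(2)] by simp
  then have "excess T (p, Suc n) - of_bool (p \<in> W) = - of_bool (p \<noteq> j)" if "p < L" for p
    using exc[of "(p, Suc n)"] that fin by (simp add: excess_rung cylinder_demand_def)
  then have "(\<Sum>p<L. excess T (p, Suc n) - of_bool (p \<in> W)) = (\<Sum>p<L. - of_bool (p \<noteq> j))"
    by (intro sum.cong) auto
  moreover have "(\<Sum>p<L. excess T (p, Suc n)) = (\<Sum>v\<in>{..<L} \<times> {Suc n}. excess T v)"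
    by (simp add: sum.cartesian_product')
  moreover have "\<dots> = 0"
    using sum_weighted_excess[of "{..<L} \<times> {Suc n}" T "\<lambda>_. 1"] assms(4) by (force simp: ring_arcs_def)
  moreover have "(\<Sum>p<L. of_bool (p \<in> W)) = int (card W)"
    using assms(3) by (simp add: sum_of_bool_eq Int_absorb1)
  moreover have "{..<L} \<inter> {p. p \<noteq> j} = {..<L} - {j}" by auto
  then have "(\<Sum>p<L. of_bool (p \<noteq> j)) = int (L - 1)"
    using assms(1) by (simp add: sum_of_bool_eq)
  ultimately have "card W = L - 1"
    by (simp add: sum_subtractf sum_negf)
  then have "card ({..<L} - W) = 1"
    using assms(1,3) fin by (simp add: card_Diff_subset)
  then obtain x where "{..<L} - W = {x}" by (auto simp: card_1_singleton_iff)
  then show ?thesis using assms(3) by (intro exI[of _ x]) auto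
qed

lemma card_flows_cylinder_Suc:
  assumes "j < L"
  shows "card (flows (cylinder_arcs L (Suc n)) (cylinder_demand L (Suc n) j))
    = (\<Sum>x<L. card (flows (cylinder_arcs L n) (cylinder_demand L n x))
        * card (flows (ring_arcs L (Suc n)) (ring_demand (Suc n) x j)))"
proof -
  let ?C = "cylinder_arcs L n" and ?R = "rung_arcs L n" and ?H = "ring_arcs L (Suc n)"
  let ?v = "\<lambda>p. ((p, n), (p, Suc n))"
  let ?X = "\<lambda>x. flows ?C (cylinder_demand L n x)" and ?Z = "\<lambda>x. flows ?H (ring_demand (Suc n) x j)"
  let ?G = "\<lambda>x (S, T). S \<union> ?v ` ({..<L} - {x}) \<union> T"
  have split: "excess (S \<union> ?v ` W \<union> T) v = excess S v + excess (?v ` W) v + excess T v"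
    if "S \<subseteq> ?C" "W \<subseteq> {..<L}" "T \<subseteq> ?H" for S W T v
  proof -
    have W: "?v ` W \<subseteq> ?R" using that(2) by (auto simp: rung_arcs_def)
    have fin: "finite S" "finite (?v ` W)" "finite T"
      using finite_subset[OF that(1)] finite_subset[OF W] finite_subset[OF that(3)]
      by (simp_all add: finite_cylinder)
    have "S \<inter> ?v ` W = {}" "(S \<union> ?v ` W) \<inter> T = {}"
      using cylinder_arcs_disjoint[of L n] that W by blast+
    then show ?thesis using fin by (simp add: excess_Un)
  qed
  have sub: "?v ` ({..<L} - {x}) \<subseteq> ?R" for x by (auto simp: rung_arcs_def)
  have inter: "?G x (S, T) \<inter> ?C = S" "?G x (S, T) \<inter> ?R = ?v ` ({..<L} - {x})" "?G x (S, T) \<inter> ?H = T"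
    if "S \<subseteq> ?C" "T \<subseteq> ?H" for x S T
    using cylinder_arcs_disjoint[of L n] that sub[of x] by auto
  have "flows (cylinder_arcs L (Suc n)) (cylinder_demand L (Suc n) j) = (\<Union>x<L. ?G x ` (?X x \<times> ?Z x))"
  proof (intro equalityI subsetI)
    fix F assume "F \<in> flows (cylinder_arcs L (Suc n)) (cylinder_demand L (Suc n) j)"
    then have F: "F \<subseteq> ?C \<union> ?R \<union> ?H" "excess F = cylinder_demand L (Suc n) j"
      by (auto simp: flows_def)
    define S where "S = F \<inter> ?C"
    define T where "T = F \<inter> ?H"
    obtain W where W: "W \<subseteq> {..<L}" "F \<inter> ?R = ?v ` W"
      using subset_imageE[of "F \<inter> ?R" ?v "{..<L}"] unfolding rung_arcs_def by blast
    have ST: "S \<subseteq> ?C" "T \<subseteq> ?H" by (auto simp: S_def T_def)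
    have F': "F = S \<union> ?v ` W \<union> T"
      using F(1) W(2) by (auto simp: S_def T_def)
    have exc: "excess S v + excess (?v ` W) v + excess T v = cylinder_demand L (Suc n) j v" for v
      using split[OF ST(1) W(1) ST(2), of v] F' F(2) by simp
    obtain x where x: "x < L" "W = {..<L} - {x}"
      using cylinder_rungs_missing_one[OF assms ST(1) W(1) ST(2) exc] by blast
    have sum: "excess S v + excess T v = cylinder_demand L n x v + ring_demand (Suc n) x j v" for v
      using exc[of v] cylinder_demand_Suc[OF x(1) assms, of n v] x(2) by simp
    \<comment> \<open>The parts live on different levels: \<open>T\<close> has no excess up to level
      \<open>n\<close> and \<open>S\<close> none above it, so the sum of their excesses determines
      both.\<close>
    have top: "excess S (p, i) = cylinder_demand L n x (p, i) \<and> excess T (p, i) = ring_demand (Suc n) x j (p, i)"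
      for p i
    proof (cases "i \<le> n")
      case True
      then have "excess T (p, i) = 0" "ring_demand (Suc n) x j (p, i) = 0"
        using excess_ring_other[OF ST(2)] by (auto simp: ring_demand_def)
      then show ?thesis using sum[of "(p, i)"] by simp
    next
      case False
      then have "excess S (p, i) = 0" "cylinder_demand L n x (p, i) = 0"
        using excess_cylinder_above[OF ST(1)] by (auto simp: cylinder_demand_def)
      then show ?thesis using sum[of "(p, i)"] by simp
    qed
    then have "S \<in> ?X x" "T \<in> ?Z x" using ST by (auto simp: flows_def)
    then show "F \<in> (\<Union>x<L. ?G x ` (?X x \<times> ?Z x))" using F' x by force
  next
    fix F assume "F \<in> (\<Union>x<L. ?G x ` (?X x \<times> ?Z x))"
    then obtain x S T where x: "x < L" "S \<in> ?X x" "T \<in> ?Z x" and F: "F = ?G x (S, T)" by auto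
    have ST: "S \<subseteq> ?C" "T \<subseteq> ?H" using x by (auto simp: flows_def)
    have "excess F v = cylinder_demand L (Suc n) j v" for v
      unfolding F cylinder_demand_Suc[OF x(1) assms] prod.case
      by (subst split) (use ST x in \<open>auto simp: flows_def\<close>)
    moreover have "F \<subseteq> cylinder_arcs L (Suc n)" using F ST sub[of x] by auto
    ultimately show "F \<in> flows (cylinder_arcs L (Suc n)) (cylinder_demand L (Suc n) j)"
      by (auto simp: flows_def)
  qed
  moreover have "card (\<Union>x<L. ?G x ` (?X x \<times> ?Z x)) = (\<Sum>x<L. card (?G x ` (?X x \<times> ?Z x)))"
  proof (rule card_UN_disjoint)
    show "\<forall>x\<in>{..<L}. finite (?G x ` (?X x \<times> ?Z x))"
      by (auto intro!: finite_flows finite_cylinder)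
    \<comment> \<open>The rungs of a composed flow reveal its \<open>x\<close>, so different gaps
      give disjoint families.\<close>
    show "\<forall>x\<in>{..<L}. \<forall>y\<in>{..<L}. x \<noteq> y \<longrightarrow> ?G x ` (?X x \<times> ?Z x) \<inter> ?G y ` (?X y \<times> ?Z y) = {}"
    proof (intro ballI impI)
      fix x y assume xy: "x \<in> {..<L}" "y \<in> {..<L}" "x \<noteq> y"
      have ne: "?v ` ({..<L} - {x}) \<noteq> ?v ` ({..<L} - {y})"
        using xy by (simp add: inj_on_image_eq_iff[OF inj_rung[of n UNIV]]) auto
      have rungs: "F \<inter> ?R = ?v ` ({..<L} - {z})" if inG: "F \<in> ?G z ` (?X z \<times> ?Z z)" for F z
      proof -
        obtain S T where ST: "S \<in> ?X z" "T \<in> ?Z z" and F: "F = ?G z (S, T)" using inG by blast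
        then have "S \<subseteq> ?C" "T \<subseteq> ?H" by (simp_all add: flows_def)
        then show ?thesis unfolding F by (rule inter(2))
      qed
      show "?G x ` (?X x \<times> ?Z x) \<inter> ?G y ` (?X y \<times> ?Z y) = {}"
      proof (rule equals0I)
        fix F assume F: "F \<in> ?G x ` (?X x \<times> ?Z x) \<inter> ?G y ` (?X y \<times> ?Z y)"
        show False
          by (rule notE[OF ne trans[OF rungs[OF IntD1[OF F], symmetric] rungs[OF IntD2[OF F]]]])
      qed
    qed
  qed simp
  moreover have "card (?G x ` (?X x \<times> ?Z x)) = card (?X x) * card (?Z x)" for x
  proof -
    have "inj_on (?G x) (?X x \<times> ?Z x)"
    proof (rule inj_on_inverseI[where g = "\<lambda>F. (F \<inter> ?C, F \<inter> ?H)"])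
      fix ST assume "ST \<in> ?X x \<times> ?Z x"
      then obtain S T where ST: "ST = (S, T)" and sub: "S \<subseteq> ?C" "T \<subseteq> ?H" by (auto simp: flows_def)
      show "(?G x ST \<inter> ?C, ?G x ST \<inter> ?H) = ST"
        unfolding ST by (simp only: inter(1)[OF sub] inter(3)[OF sub])
    qed
    then show ?thesis by (simp add: card_image card_cartesian_product)
  qed
  ultimately show ?thesis by simp
qed

text \<open>By induction, and because an unmoved gap gives a factor 2, only the \<open>x\<close>
  outside \<open>{0, j}\<close> count modulo 2. There are \<open>L - 1\<close> of them if
  \<open>j = 0\<close> and \<open>L - 2\<close> otherwise.\<close>

lemma odd_card_flows_cylinder:
  assumes "odd L" "j < L"
  shows "odd (card (flows (cylinder_arcs L n) (cylinder_demand L n j))) \<longleftrightarrow> j \<noteq> 0"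
  using assms(2)
proof (induction n arbitrary: j)
  case 0
  \<comment> \<open>On a single ring the bottom and top demands overlap; what remains is a gap
    moving from \<open>0\<close> to \<open>j\<close>.\<close>
  have "cylinder_demand L 0 j = ring_demand 0 0 j"
    using 0 by (auto simp: cylinder_demand_def ring_demand_def of_bool_def fun_eq_iff)
  then show ?case using card_flows_ring[of 0 L j 0] 0 by simp
next
  case (Suc n)
  have "{x \<in> {..<L}. odd (card (flows (cylinder_arcs L n) (cylinder_demand L n x))
      * card (flows (ring_arcs L (Suc n)) (ring_demand (Suc n) x j)))} = {..<L} - {0, j}"
    using Suc by (auto simp: card_flows_ring)
  then have "odd (card (flows (cylinder_arcs L (Suc n)) (cylinder_demand L (Suc n) j)))
      \<longleftrightarrow> odd (card ({..<L} - {0, j}))"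
    unfolding card_flows_cylinder_Suc[OF Suc.prems] by (subst even_sum_iff) auto
  also have "\<dots> \<longleftrightarrow> j \<noteq> 0"
  proof (cases "j = 0")
    case False
    then have "card ({..<L} - {0, j}) = L - 2"
      using Suc.prems by (subst card_Diff_subset) auto
    then show ?thesis using assms(1) False Suc.prems by auto
  qed (use assms(1) Suc.prems in auto)
  finally show ?case .
qed

section \<open>The Alon-Tarsi theorem\<close>

lemma in_degree_with_proj: "in_degree (with_proj G) v = indeg (parcs G) v"
  by (simp add: in_degree_def in_arcs_def indeg_def)

lemma out_degree_with_proj: "out_degree (with_proj G) v = outdeg (parcs G) v"
  by (simp add: out_degree_def out_arcs_def outdeg_def)

lemma circulation_iff_flow:
  assumes "finite (pverts D)" "parcs D \<subseteq> pverts D \<times> pverts D"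
  shows "circulation E D \<longleftrightarrow> pverts E = pverts D \<and> parcs E \<in> flows (parcs D) (\<lambda>_. 0)"
proof -
  have fin: "finite (parcs D)" using assms by (meson finite_SigmaI finite_subset)
  have wf: "pair_wf_digraph F" if "pverts F = pverts D" "parcs F \<subseteq> parcs D" for F
    using that assms(2) by unfold_locales auto
  have span: "spanning (with_proj E) (with_proj D) \<longleftrightarrow> pverts E = pverts D \<and> parcs E \<subseteq> parcs D"
    using wf[of E] wf[of D] by (auto simp: spanning_def subgraph_def compatible_def wf_digraph_wp_iff)
  have bal: "(\<forall>v\<in>pverts D. in_degree (with_proj E) v = out_degree (with_proj E) v)
      \<longleftrightarrow> excess (parcs E) = (\<lambda>_. 0)" if sub: "parcs E \<subseteq> parcs D"
  proof -
    have finE: "finite (parcs E)" using finite_subset[OF sub fin] .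
    have "excess (parcs E) v = 0" if "v \<notin> pverts D" for v
      by (rule excess_eq_0) (use that sub assms(2) in auto)
    then have "excess (parcs E) = (\<lambda>_. 0) \<longleftrightarrow> (\<forall>v\<in>pverts D. excess (parcs E) v = 0)"
      by (auto simp: fun_eq_iff)
    then show ?thesis
      by (auto simp: in_degree_with_proj out_degree_with_proj excess_eq_outdeg_indeg[OF finE])
  qed
  show ?thesis unfolding circulation_def span flows_def using bal by blast
qed

text \<open>A spanning subdigraph keeps all vertices, so its arcs determine it and circulations can
  be counted as arc sets.\<close>

lemma card_circulations:
  assumes "finite (pverts D)" "parcs D \<subseteq> pverts D \<times> pverts D"
  shows "card {E. circulation E D \<and> P (card (parcs E))} = card {S \<in> flows (parcs D) (\<lambda>_. 0). P (card S)}"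
proof -
  let ?g = "\<lambda>S. \<lparr>pverts = pverts D, parcs = S\<rparr>"
  have "{E. circulation E D \<and> P (card (parcs E))} = ?g ` {S \<in> flows (parcs D) (\<lambda>_. 0). P (card S)}"
  proof (intro equalityI subsetI)
    fix E assume "E \<in> {E. circulation E D \<and> P (card (parcs E))}"
    then have "E = ?g (parcs E)" "parcs E \<in> {S \<in> flows (parcs D) (\<lambda>_. 0). P (card S)}"
      using circulation_iff_flow[OF assms, of E] by auto
    then show "E \<in> ?g ` {S \<in> flows (parcs D) (\<lambda>_. 0). P (card S)}" by (rule image_eqI)
  next
    fix E assume "E \<in> ?g ` {S \<in> flows (parcs D) (\<lambda>_. 0). P (card S)}"
    then show "E \<in> {E. circulation E D \<and> P (card (parcs E))}"
      using circulation_iff_flow[OF assms] by auto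
  qed
  moreover have "inj_on ?g X" for X by (auto simp: inj_on_def)
  ultimately show ?thesis by (simp add: card_image)
qed

text \<open>The total serves the parity argument: if it is odd, the two counts differ. The signed
  sum is the quantity that \<open>ex_proper_choice\<close> requires to be nonzero.\<close>

lemma circulation_counts:
  assumes "finite (pverts D)" "parcs D \<subseteq> pverts D \<times> pverts D"
  shows "card (even_circulations D) + card (odd_circulations D) = card (flows (parcs D) (\<lambda>_. 0))"
    and "real (card (even_circulations D)) - real (card (odd_circulations D))
      = (\<Sum>S\<in>flows (parcs D) (\<lambda>_. 0). (-1) ^ card S)"
proof -
  let ?F = "flows (parcs D) (\<lambda>_. 0)"
  have fin: "finite ?F" using assms by (meson finite_SigmaI finite_subset finite_flows)
  have ev: "card (even_circulations D) = card {S \<in> ?F. even (card S)}"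
    unfolding even_circulations_def by (rule card_circulations[OF assms])
  have od: "card (odd_circulations D) = card {S \<in> ?F. odd (card S)}"
    unfolding odd_circulations_def by (rule card_circulations[OF assms])
  have un: "?F = {S \<in> ?F. even (card S)} \<union> {S \<in> ?F. odd (card S)}" by blast
  have disj: "{S \<in> ?F. even (card S)} \<inter> {S \<in> ?F. odd (card S)} = {}" by blast
  have fins: "finite {S \<in> ?F. even (card S)}" "finite {S \<in> ?F. odd (card S)}" using fin by simp_all
  show "card (even_circulations D) + card (odd_circulations D) = card ?F"
    unfolding ev od card_Un_disjoint[OF fins disj, symmetric] un[symmetric] ..
  have "(\<Sum>S\<in>?F. (-1) ^ card S) = (\<Sum>S\<in>{S \<in> ?F. even (card S)}. (-1) ^ card S)
      + (\<Sum>S\<in>{S \<in> ?F. odd (card S)}. (-1) ^ card S :: real)"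
    by (subst un, rule sum.union_disjoint[OF fins disj])
  then show "real (card (even_circulations D)) - real (card (odd_circulations D))
      = (\<Sum>S\<in>?F. (-1) ^ card S)"
    unfolding ev od by simp
qed

lemma orientation_arcs:
  assumes "pair_graph G" "orientation D G"
  shows "finite (pverts D)" "parcs D \<subseteq> pverts D \<times> pverts D"
  using assms pair_graphD[OF assms(1)] pair_graph_finite_verts[OF assms(1)]
  by (auto simp: orientation_def)

lemma indeg_le_max_in_degree:
  "finite (pverts D) \<Longrightarrow> v \<in> pverts D \<Longrightarrow> indeg (parcs D) v \<le> max_in_degree D"
  by (simp add: max_in_degree_def in_degree_with_proj)

text \<open>The colours are embedded into the reals and \<open>ex_proper_choice\<close> is applied
  to the arcs of \<open>D\<close>, which contain every edge in one direction.\<close>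

theorem alon_tarsi:
  fixes L :: "'a \<Rightarrow> nat set"
  assumes G: "pair_graph G" and D: "orientation D G"
    and ne: "card (even_circulations D) \<noteq> card (odd_circulations D)"
    and L: "\<And>v. v \<in> pverts G \<Longrightarrow> finite (L v) \<and> max_in_degree D + 1 \<le> card (L v)"
  shows "\<exists>f. proper_coloring G f \<and> (\<forall>v\<in>pverts G. f v \<in> L v)"
proof -
  note wf = orientation_arcs[OF G D]
  have V: "pverts D = pverts G" using D by (simp add: orientation_def)
  \<comment> \<open>\<open>ex_proper_choice\<close> asks for exactly one colour more than the
    indegree, so each list is trimmed to that size.\<close>
  have "\<exists>M. M \<subseteq> L v \<and> card M = Suc (indeg (parcs D) v) \<and> finite M" if "v \<in> pverts G" for v
    using obtain_subset_with_card_n[of "Suc (indeg (parcs D) v)" "L v"] L[OF that]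
      indeg_le_max_in_degree[OF wf(1), of v] that V by (metis Suc_eq_plus1 Suc_le_mono le_trans)
  then obtain M where M: "\<And>v. v \<in> pverts G \<Longrightarrow>
      M v \<subseteq> L v \<and> card (M v) = Suc (indeg (parcs D) v) \<and> finite (M v)"
    by metis
  have "(\<Sum>S\<in>flows (parcs D) (\<lambda>_. 0). (-1) ^ card S) \<noteq> (0::real)"
    using circulation_counts(2)[OF wf] ne by simp
  then have "\<exists>x. (\<forall>v\<in>pverts G. x v \<in> real ` M v) \<and> (\<forall>(u, v)\<in>parcs D. x u \<noteq> x v)"
    using wf V M by (intro ex_proper_choice) (auto simp: card_image)
  then obtain x where x: "\<And>v. v \<in> pverts G \<Longrightarrow> x v \<in> real ` M v"
    "\<And>u v. (u, v) \<in> parcs D \<Longrightarrow> x u \<noteq> x v" by blast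
  from x(1) have "\<forall>v\<in>pverts G. \<exists>c\<in>M v. x v = real c" by blast
  then obtain f where f: "\<And>v. v \<in> pverts G \<Longrightarrow> f v \<in> M v \<and> x v = real (f v)" by metis
  have "f u \<noteq> f v" if uv: "(u, v) \<in> parcs G" for u v
  proof -
    have "(u, v) \<in> parcs D \<or> (v, u) \<in> parcs D" using D uv by (auto simp: orientation_def)
    then have "x u \<noteq> x v" using x(2)[of u v] x(2)[of v u] by auto
    then show ?thesis using f pair_graphD(1,2)[OF G uv] by metis
  qed
  moreover have "f v \<in> L v" if "v \<in> pverts G" for v
    using f[OF that] M[OF that] by blast
  ultimately show ?thesis by (auto simp: proper_coloring_def)
qed

section \<open>The orientation and the colouring bound\<close>

lemma reversed_arcs_orient:
  assumes "A \<inter> prod.swap ` A = {}" "T \<subseteq> A" "(u, v) \<in> A \<union> prod.swap ` A"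
  shows "(u, v) \<in> (A - T) \<union> prod.swap ` T \<longleftrightarrow> (v, u) \<notin> (A - T) \<union> prod.swap ` T"
proof -
  have sw: "(a, b) \<in> prod.swap ` B \<longleftrightarrow> (b, a) \<in> B" for a b and B :: "('a \<times> 'a) set" by force
  have "\<not> ((u, v) \<in> A \<and> (v, u) \<in> A)" using assms(1) sw by blast
  then show ?thesis using assms(2,3) by (auto simp: sw)
qed

text \<open>At \<open>v\<close>, each outgoing arc of \<open>T\<close> becomes an incoming one and
  each incoming arc of \<open>T\<close> is lost.\<close>

lemma indeg_reversed_arcs:
  assumes "finite A" "A \<inter> prod.swap ` A = {}" "T \<subseteq> A"
  shows "int (indeg ((A - T) \<union> prod.swap ` T) v) = int (indeg A v) + excess T v"
proof -
  have fin: "finite T" using finite_subset[OF assms(3,1)] .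
  have "{e \<in> A. snd e = v} = {e \<in> A - T. snd e = v} \<union> {e \<in> T. snd e = v}"
    using assms(3) by blast
  then have "indeg A v = indeg (A - T) v + indeg T v"
    unfolding indeg_def using assms(1) fin by (simp add: card_Un_disjoint disjoint_iff)
  moreover have "indeg ((A - T) \<union> prod.swap ` T) v = indeg (A - T) v + outdeg T v"
  proof -
    have "{e \<in> (A - T) \<union> prod.swap ` T. snd e = v}
        = {e \<in> A - T. snd e = v} \<union> prod.swap ` {e \<in> T. fst e = v}" by force
    moreover have "{e \<in> A - T. snd e = v} \<inter> prod.swap ` {e \<in> T. fst e = v} = {}"
      using assms(2,3) by blast
    ultimately show ?thesis
      unfolding indeg_def outdeg_def using assms(1) fin
      by (simp add: card_Un_disjoint card_image)
  qed
  ultimately show ?thesis by (simp add: excess_eq_outdeg_indeg[OF fin])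
qed

lemma mem_cylinder_arcs:
  "((p, i), (q, i')) \<in> cylinder_arcs L n \<longleftrightarrow> p < L \<and> q < L \<and> i \<le> n \<and> i' \<le> n
    \<and> (i = i' \<and> q = Suc p mod L \<or> p = q \<and> i' = Suc i)"
  by (induction n) (auto simp: ring_arcs_def rung_arcs_def)

lemma cylinder_arcs_antisym:
  assumes "L \<ge> 3"
  shows "cylinder_arcs L n \<inter> prod.swap ` cylinder_arcs L n = {}"
proof -
  \<comment> \<open>Two steps forward on a ring of length at least 3 never return to the
    start.\<close>
  have "p \<noteq> Suc (Suc p mod L) mod L" if "p < L" for p
    using that assms by (auto simp: mod_Suc split: if_splits)
  then have "e \<notin> cylinder_arcs L n" if "prod.swap e \<in> cylinder_arcs L n" for e
    using that assms by (cases e) (auto simp: mem_cylinder_arcs)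
  then show ?thesis by force
qed

lemma indeg_cylinder_arcs: "p < L \<Longrightarrow> indeg (cylinder_arcs L n) (p, i) \<le> 1 + of_bool (i > 0)"
proof -
  assume "p < L"
  then obtain q where q: "q < L" "p = Suc q mod L" using Suc_mod_surj by blast
  have "{e \<in> cylinder_arcs L n. snd e = (p, i)}
      \<subseteq> {((q, i), (p, i))} \<union> (if i = 0 then {} else {((p, i - 1), (p, i))})"
    using q by (auto simp: mem_cylinder_arcs Suc_mod_inj)
  then have "indeg (cylinder_arcs L n) (p, i)
      \<le> card ({((q, i), (p, i))} \<union> (if i = 0 then {} else {((p, i - 1), (p, i))}))"
    unfolding indeg_def by (intro card_mono) auto
  also have "\<dots> \<le> 1 + of_bool (i > 0)" by (auto simp: card_insert_if)
  finally show ?thesis .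
qed

text \<open>Reversing a flow adds its excess to the indegrees. The reference indegrees are at most 1
  in the bottom ring and 2 elsewhere, and the demand is positive only in the bottom ring, where it
  is at most 1.\<close>

lemma ex_cylinder_orientation:
  assumes "odd L" "L \<ge> 3"
  shows "\<exists>T \<subseteq> cylinder_arcs L n. let X = (cylinder_arcs L n - T) \<union> prod.swap ` T in
    odd (card (flows X (\<lambda>_. 0))) \<and> (\<forall>p i. p < L \<longrightarrow> indeg X (p, i) \<le> 2)"
proof -
  let ?A = "cylinder_arcs L n" and ?d = "cylinder_demand L n 1"
  have anti: "?A \<inter> prod.swap ` ?A = {}" by (rule cylinder_arcs_antisym[OF assms(2)])
  \<comment> \<open>The gap position \<open>1\<close> is nonzero, so the count is odd; being
    positive, it also supplies \<open>T\<close>.\<close>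
  have odd: "odd (card (flows ?A ?d))" using odd_card_flows_cylinder[OF assms(1), of 1 n] assms(2) by simp
  then have "flows ?A ?d \<noteq> {}" by fastforce
  then obtain T where T: "T \<in> flows ?A ?d" by blast
  then have sub: "T \<subseteq> ?A" and exc: "excess T = ?d" by (auto simp: flows_def)
  have "indeg ((?A - T) \<union> prod.swap ` T) (p, i) \<le> 2" if "p < L" for p i
    using indeg_reversed_arcs[OF finite_cylinder(3) anti sub, of "(p, i)"] indeg_cylinder_arcs[OF that, of n i]
    by (cases "i = 0") (auto simp: exc cylinder_demand_def of_bool_def split: if_splits)
  then show ?thesis
    using sub odd card_flows_reverse[OF finite_cylinder(3) anti T] unfolding Let_def by auto
qed

lemma card_flows_image:
  assumes "inj f"
  shows "card (flows (map_prod f f ` A) (\<lambda>_. 0)) = card (flows A (\<lambda>_. 0))"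
proof -
  have "excess (map_prod f f ` S) = (\<lambda>_. 0) \<longleftrightarrow> excess S = (\<lambda>_. 0)" for S
  proof -
    have "excess (map_prod f f ` S) v = 0" if "v \<notin> range f" for v
      using that by (intro excess_eq_0) auto
    then show ?thesis using excess_image_inj[OF assms] by (metis rangeE)
  qed
  then have "flows (map_prod f f ` A) (\<lambda>_. 0) = image (map_prod f f) ` flows A (\<lambda>_. 0)"
    by (auto simp: flows_def subset_image_iff)
  moreover have "inj (image (map_prod f f))"
    by (rule inj_on_image) (simp add: assms prod.inj_map)
  ultimately show ?thesis by (metis card_image inj_on_subset subset_UNIV)
qed

text \<open>With only the colours of \<open>0\<close> and \<open>1\<close>, the colouring would
  alternate, giving the even position \<open>L - 1\<close> the colour of its neighbour
  \<open>0\<close>.\<close>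

lemma odd_cycle_third_color:
  fixes g :: "nat \<Rightarrow> 'c"
  assumes "odd L" "\<And>p. p < L \<Longrightarrow> g p \<noteq> g (Suc p mod L)"
  shows "\<exists>p<L. g p \<noteq> g 0 \<and> g p \<noteq> g 1"
proof (rule ccontr)
  assume two: "\<not> ?thesis"
  have "g p = (if even p then g 0 else g 1)" if "p < L" for p
    using that
  proof (induction p)
    case (Suc p)
    then have "g p \<noteq> g (Suc p)" using assms(2)[of p] by simp
    moreover have "g (Suc p) = g 0 \<or> g (Suc p) = g 1" using two Suc.prems by blast
    ultimately show ?case using Suc by (auto split: if_splits)
  qed simp
  from this[of "L - 1"] have "g (L - 1) = g 0" using assms(1) by (auto elim: oddE)
  moreover have "g (L - 1) \<noteq> g 0" using assms(2)[of "L - 1"] assms(1) by (auto elim: oddE)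
  ultimately show False by simp
qed


section \<open>Orientation of the whole product graph\<close>

lemma mem_complete_join_cycle_path:
  fixes m L n :: nat
  defines "G \<equiv> cartesian_product (graph_join (complete_graph m) (cycle_graph L)) (path_graph n)"
  shows "((Inl u, i), (Inl v, i')) \<in> parcs G \<longleftrightarrow> u < m \<and> v < m \<and> i < n \<and> i' < n
      \<and> (u = v \<and> (i' = Suc i \<or> i = Suc i') \<or> i = i' \<and> u \<noteq> v)"
    and "((Inl u, i), (Inr p, i')) \<in> parcs G \<longleftrightarrow> u < m \<and> p < L \<and> i < n \<and> i = i'"
    and "((Inr p, i), (Inl u, i')) \<in> parcs G \<longleftrightarrow> u < m \<and> p < L \<and> i < n \<and> i = i'"
    and "((Inr p, i), (Inr q, i')) \<in> parcs G \<longleftrightarrow> p < L \<and> q < L \<and> i < n \<and> i' < n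
      \<and> (p = q \<and> (i' = Suc i \<or> i = Suc i') \<or> i = i' \<and> (q = Suc p mod L \<or> p = Suc q mod L))"
  unfolding G_def
  by (auto simp: cartesian_product_def graph_join_def complete_graph_def cycle_graph_def path_graph_def)

lemma pverts_complete_join_cycle_path:
  "pverts (cartesian_product (graph_join (complete_graph m) (cycle_graph L)) (path_graph n))
    = ({..<m} <+> {..<L}) \<times> {..<n}"
  by (simp add: cartesian_product_def graph_join_def complete_graph_def cycle_graph_def path_graph_def)

text \<open>Between clique vertices \<open>u + i\<close> increases along every arc, and cycle
  vertices have no outgoing arcs, so this orientation is acyclic.\<close>

definition clique_arcs :: "nat \<Rightarrow> nat \<Rightarrow> nat \<Rightarrow> (((nat + nat) \<times> nat) \<times> ((nat + nat) \<times> nat)) set" where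
  "clique_arcs m L n = {((Inl u, i), (Inl v, i)) |u v i. u < v \<and> v < m \<and> i < n}
    \<union> {((Inl u, i), (Inl u, Suc i)) |u i. u < m \<and> Suc i < n}
    \<union> {((Inl u, i), (Inr p, i)) |u p i. u < m \<and> p < L \<and> i < n}"

lemma mem_clique_arcs:
  "((Inl u, i), (Inl v, i')) \<in> clique_arcs m L n \<longleftrightarrow>
    (i' = i \<and> u < v \<and> v < m \<and> i < n \<or> v = u \<and> i' = Suc i \<and> u < m \<and> Suc i < n)"
  "((Inl u, i), (Inr p, i')) \<in> clique_arcs m L n \<longleftrightarrow> i' = i \<and> u < m \<and> p < L \<and> i < n"
  "((Inr p, i), w) \<notin> clique_arcs m L n"
  by (auto simp: clique_arcs_def)

text \<open>A clique vertex receives an arc from each smaller index and at most one from the level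
  below, so at most \<open>v + 1\<close> in all. A cycle vertex receives arcs only from the clique
  copy of its level.\<close>

lemma indeg_clique_arcs:
  "indeg (clique_arcs m L n) (Inr p, i) \<le> m"
  "v < m \<Longrightarrow> indeg (clique_arcs m L n) (Inl v, i) \<le> m"
proof -
  have "{e \<in> clique_arcs m L n. snd e = (Inr p, i)} \<subseteq> (\<lambda>u. ((Inl u, i), (Inr p, i))) ` {..<m}"
    by (auto simp: clique_arcs_def)
  then show "indeg (clique_arcs m L n) (Inr p, i) \<le> m"
    unfolding indeg_def using surj_card_le[of "{..<m}"] by fastforce
next
  assume v: "v < m"
  \<comment> \<open>At \<open>i = 0\<close> the truncated \<open>i - 1\<close> inserts a loop that
    is not an arc; it only enlarges the upper bound.\<close>
  have "{e \<in> clique_arcs m L n. snd e = (Inl v, i)}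
      \<subseteq> insert ((Inl v, i - 1), (Inl v, i)) ((\<lambda>u. ((Inl u, i), (Inl v, i))) ` {..<v})"
    (is "_ \<subseteq> insert ?e (?h ` _)")
    by (auto simp: clique_arcs_def)
  then have "indeg (clique_arcs m L n) (Inl v, i) \<le> card (insert ?e (?h ` {..<v}))"
    unfolding indeg_def by (intro card_mono) auto
  also have "\<dots> \<le> Suc (card (?h ` {..<v}))"
    by (simp add: card_insert_if)
  also have "\<dots> \<le> Suc v"
    using card_image_le[of "{..<v}" ?h] by simp
  finally show "indeg (clique_arcs m L n) (Inl v, i) \<le> m" using v by simp
qed

text \<open>Cycle vertices receive at most \<open>m\<close> arcs from the clique copy and 2 from the
  cylinder. The circulations are those of the cylinder, and their odd total makes the two counts
  differ.\<close>

lemma ex_orientation_complete_join_cycle_path: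
  fixes m L n :: nat
  assumes "odd L" "L \<ge> 3" "n > 0"
  defines "G \<equiv> cartesian_product (graph_join (complete_graph m) (cycle_graph L)) (path_graph n)"
  shows "\<exists>D. orientation D G \<and> max_in_degree D + 1 \<le> m + 3
    \<and> card (even_circulations D) \<noteq> card (odd_circulations D)"
proof -
  \<comment> \<open>\<open>cylinder_arcs L N\<close> has \<open>N + 1\<close> rings, one for each of
    the \<open>n\<close> path vertices.\<close>
  obtain N where N: "n = Suc N" using assms(3) by (cases n) auto
  define \<phi> :: "nat \<times> nat \<Rightarrow> (nat + nat) \<times> nat" where "\<phi> = map_prod Inr id"
  have inj: "inj \<phi>" unfolding \<phi>_def by (intro prod.inj_map) auto
  let ?A = "cylinder_arcs L N"
  obtain T where T: "T \<subseteq> ?A" and X: "odd (card (flows ((?A - T) \<union> prod.swap ` T) (\<lambda>_. 0)))"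
      "\<And>p i. p < L \<Longrightarrow> indeg ((?A - T) \<union> prod.swap ` T) (p, i) \<le> 2"
    using ex_cylinder_orientation[OF assms(1,2), of N] unfolding Let_def by blast
  define X where "X = (?A - T) \<union> prod.swap ` T"
  define Y where "Y = map_prod \<phi> \<phi> ` X"
  define B where "B = clique_arcs m L n"
  define D where "D = \<lparr>pverts = pverts G, parcs = Y \<union> B\<rparr>"
  have Y: "((Inl u, i), w) \<notin> Y" "(w, (Inl u, i)) \<notin> Y"
    "((Inr p, i), (Inr q, i')) \<in> Y \<longleftrightarrow> ((p, i), (q, i')) \<in> X" for u i w p q i'
    by (auto simp: Y_def \<phi>_def) force
  have anti: "?A \<inter> prod.swap ` ?A = {}" by (rule cylinder_arcs_antisym[OF assms(2)])
  have XA: "X \<subseteq> ?A \<union> prod.swap ` ?A" using T by (auto simp: X_def)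
  have swap: "(a, b) \<in> prod.swap ` ?A \<longleftrightarrow> (b, a) \<in> ?A" for a b by force
  have cyl: "((Inr p, i), (Inr q, i')) \<in> parcs G \<longleftrightarrow> ((p, i), (q, i')) \<in> ?A \<union> prod.swap ` ?A" for p q i i'
    unfolding G_def mem_complete_join_cycle_path Un_iff swap mem_cylinder_arcs N by auto
  have G: "pair_graph G"
    unfolding G_def using assms(2)
    by (intro pair_graph_cartesian_product pair_graph_graph_join pair_graph_complete_graph
        pair_graph_cycle_graph pair_graph_path_graph)
  have ori: "orientation D G"
    unfolding orientation_def
  proof (intro conjI subsetI ballI)
    show "pverts D = pverts G" by (simp add: D_def)
  next
    fix e assume e: "e \<in> parcs D"
    obtain x i y i' where [simp]: "e = ((x, i), (y, i'))" by (cases e) auto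
    show "e \<in> parcs G"
    proof (cases x)
      case [simp]: (Inl u)
      then show ?thesis
        using e by (cases y)
          (auto simp: D_def B_def Y mem_clique_arcs mem_complete_join_cycle_path G_def)
    next
      case [simp]: (Inr p)
      then show ?thesis
        using e XA by (cases y) (auto simp: D_def B_def Y mem_clique_arcs cyl)
    qed
  next
    fix e assume e: "e \<in> parcs G"
    obtain x i y i' where [simp]: "e = ((x, i), (y, i'))" by (cases e) auto
    have "((x, i), (y, i')) \<in> parcs D \<longleftrightarrow> ((y, i'), (x, i)) \<notin> parcs D"
    proof (cases "\<exists>p q. x = Inr p \<and> y = Inr q")
      case True
      then obtain p q where [simp]: "x = Inr p" "y = Inr q" by blast
      have "((p, i), (q, i')) \<in> ?A \<union> prod.swap ` ?A" using e cyl by simp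
      then have "((p, i), (q, i')) \<in> X \<longleftrightarrow> ((q, i'), (p, i)) \<notin> X"
        unfolding X_def by (rule reversed_arcs_orient[OF anti T])
      then show ?thesis by (simp add: D_def B_def Y mem_clique_arcs)
    next
      case False
      then show ?thesis
        using e by (cases x; cases y)
          (auto simp: D_def B_def Y mem_clique_arcs mem_complete_join_cycle_path G_def)
    qed
    then show "case e of (u, v) \<Rightarrow> (u, v) \<in> parcs D \<longleftrightarrow> (v, u) \<notin> parcs D" by simp
  qed
  note wf = orientation_arcs[OF G ori]
  have fin: "finite (Y \<union> B)"
    using finite_subset[OF wf(2)] wf(1) unfolding D_def by simp
  have indegY: "indeg Y (Inr p, i) = indeg X (p, i)" for p i
  proof -
    have "{e \<in> Y. snd e = (Inr p, i)} = map_prod \<phi> \<phi> ` {e \<in> X. snd e = (p, i)}"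
      unfolding Y_def \<phi>_def by force
    moreover have "inj_on (map_prod \<phi> \<phi>) {e \<in> X. snd e = (p, i)}"
      using inj_on_subset[OF prod.inj_map[OF inj inj]] by simp
    ultimately show ?thesis unfolding indeg_def by (simp only: card_image)
  qed
  have Un: "indeg (Y \<union> B) v \<le> indeg Y v + indeg B v" for v
  proof -
    have "{e \<in> Y \<union> B. snd e = v} = {e \<in> Y. snd e = v} \<union> {e \<in> B. snd e = v}" by blast
    then show ?thesis unfolding indeg_def by (simp add: card_Un_le)
  qed
  have deg: "indeg (parcs D) v \<le> m + 2" if v: "v \<in> pverts G" for v
  proof -
    obtain x i where [simp]: "v = (x, i)" by (cases v) auto
    show ?thesis
    proof (cases x)
      case (Inl u)
      have "{e \<in> Y. snd e = (Inl u, i)} = {}" using Y(2)[of _ u i] by fastforce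
      then have "indeg Y (Inl u, i) = 0" by (simp only: indeg_def card.empty)
      moreover have "u < m" using v Inl by (auto simp: G_def pverts_complete_join_cycle_path)
      ultimately show ?thesis
        using Un[of v] indeg_clique_arcs(2)[of u m L n i] Inl by (simp add: D_def B_def)
    next
      case (Inr p)
      have "p < L" using v Inr by (auto simp: G_def pverts_complete_join_cycle_path)
      then show ?thesis
        using Un[of v] indeg_clique_arcs(1)[of m L n p i] X(2)[of p i] Inr
        by (simp add: D_def B_def indegY X_def[symmetric])
    qed
  qed
  have "(Inr 0, 0) \<in> pverts G"
    using assms(2,3) by (auto simp: G_def pverts_complete_join_cycle_path)
  then have "max_in_degree D \<le> m + 2"
    using wf(1) deg unfolding max_in_degree_def in_degree_with_proj
    by (subst Max_le_iff) (auto simp: D_def)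
  moreover have "card (even_circulations D) \<noteq> card (odd_circulations D)"
  proof -
    \<comment> \<open>A potential for \<open>flows_zero_confined\<close>: it is constant on the
      cylinder, where \<open>m + n\<close> exceeds every \<open>u + i\<close> of a clique vertex,
      and rises strictly along \<open>B\<close>.\<close>
    define r :: "(nat + nat) \<times> nat \<Rightarrow> int" where
      "r v = (case fst v of Inl u \<Rightarrow> int (u + snd v) | Inr p \<Rightarrow> int (m + n))" for v
    have "flows (Y \<union> B) (\<lambda>_. 0) = flows Y (\<lambda>_. 0)"
      by (rule flows_zero_confined[where r = r, OF fin])
        (auto simp: Y_def B_def clique_arcs_def r_def \<phi>_def)
    then have "card (flows (parcs D) (\<lambda>_. 0)) = card (flows X (\<lambda>_. 0))"
      using card_flows_image[OF inj, of X] by (simp add: D_def Y_def)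
    then have "odd (card (even_circulations D) + card (odd_circulations D))"
      using circulation_counts(1)[OF wf] X(1) by (simp add: X_def)
    then show ?thesis by auto
  qed
  ultimately show ?thesis using ori by (intro exI[of _ D]) simp
qed

section \<open>Chromatic lower bound and conclusion\<close>

text \<open>Level \<open>0\<close> already contains the clique joined to the odd cycle:
  \<open>m\<close> colours on the clique and at least three others on the cycle.\<close>

lemma colors_complete_join_cycle_path:
  fixes m L n c :: nat
  assumes "odd L" "L \<ge> 3" "n > 0"
  defines "G \<equiv> cartesian_product (graph_join (complete_graph m) (cycle_graph L)) (path_graph n)"
  assumes f: "proper_coloring G f" "f ` pverts G \<subseteq> {..<c}"
  shows "m + 3 \<le> c"
proof -
  define h where "h u = f (Inl u, 0)" for u
  define g where "g p = f (Inr p, 0)" for p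
  have ne: "f u \<noteq> f v" if "(u, v) \<in> parcs G" for u v
    using f(1) that by (auto simp: proper_coloring_def)
  have "g p \<noteq> g (Suc p mod L)" if "p < L" for p
    unfolding g_def by (rule ne) (use that assms(3) in \<open>auto simp: G_def mem_complete_join_cycle_path\<close>)
  then obtain p where p: "p < L" "g p \<noteq> g 0" "g p \<noteq> g 1"
    using odd_cycle_third_color[OF assms(1)] by metis
  have "g 0 \<noteq> g 1"
    unfolding g_def by (rule ne) (use assms(2,3) in \<open>auto simp: G_def mem_complete_join_cycle_path\<close>)
  then have three: "card {g 0, g 1, g p} = 3" using p by simp
  have "inj_on h {..<m}"
    unfolding inj_on_def h_def
    using ne assms(3) by (force simp: G_def mem_complete_join_cycle_path)
  then have "card (h ` {..<m}) = m" by (simp add: card_image)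
  moreover have sep: "h u \<noteq> g q" if "u < m" "q < L" for u q
    unfolding h_def g_def by (rule ne) (use that assms(3) in \<open>auto simp: G_def mem_complete_join_cycle_path\<close>)
  have "h ` {..<m} \<inter> {g 0, g 1, g p} = {}"
    using sep[of _ 0] sep[of _ 1] sep[of _ p] p(1) assms(2) by fastforce
  ultimately have total: "card (h ` {..<m} \<union> {g 0, g 1, g p}) = m + 3"
    by (subst card_Un_disjoint) (simp_all only: three finite_imageI finite_lessThan finite.intros)
  have "h ` {..<m} \<union> {g 0, g 1, g p} \<subseteq> {..<c}"
  proof -
    have "f v < c" if "v \<in> pverts G" for v using f(2) that by blast
    then have "u < m \<Longrightarrow> h u < c" "q < L \<Longrightarrow> g q < c" for u q
      using assms(3) by (auto simp: h_def g_def G_def pverts_complete_join_cycle_path)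
    then show ?thesis using p(1) assms(2) by auto
  qed
  from card_mono[OF finite_lessThan this] show ?thesis
    unfolding total by (simp only: card_lessThan)
qed

theorem corollary11:
  fixes m k n :: nat
  assumes "m > 0" and "k > 0" and "n > 0"
  shows "alon_tarsi_number
           (cartesian_product (graph_join (complete_graph m) (cycle_graph (2 * k + 1)))
              (path_graph n)) = m + 3
       \<and> chromatic_choosable
           (cartesian_product (graph_join (complete_graph m) (cycle_graph (2 * k + 1)))
              (path_graph n))"
proof -
  let ?L = "2 * k + 1"
  define G where "G = cartesian_product (graph_join (complete_graph m) (cycle_graph ?L)) (path_graph n)"
  \<comment> \<open>\<open>k > 0\<close> makes the length at least 3, so \<open>cycle_graph\<close>
    is a genuine cycle.\<close>
  have L: "odd ?L" "?L \<ge> 3" using assms(2) by auto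
  have G: "pair_graph G"
    unfolding G_def using L(2)
    by (intro pair_graph_cartesian_product pair_graph_graph_join pair_graph_complete_graph
        pair_graph_cycle_graph pair_graph_path_graph)
  \<comment> \<open>\<open>P\<close>, \<open>Q\<close> and \<open>R\<close> are the predicates under
    the three \<open>LEAST\<close> operators. Their least values satisfy \<open>R\<close> \<le>
    \<open>Q\<close> \<le> \<open>P\<close> \<le> \<open>m + 3\<close> \<le> \<open>R\<close>, so
    all are equal.\<close>
  define P where "P a \<longleftrightarrow> (\<exists>D. orientation D G \<and> max_in_degree D + 1 = a
     \<and> card (even_circulations D) \<noteq> card (odd_circulations D))" for a
  define Q where "Q a \<longleftrightarrow> (\<forall>L :: (nat + nat) \<times> nat \<Rightarrow> nat set.
     (\<forall>v \<in> pverts G. finite (L v) \<and> a \<le> card (L v)) \<longrightarrow>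
     (\<exists>f. proper_coloring G f \<and> (\<forall>v \<in> pverts G. f v \<in> L v)))" for a
  define R where "R a \<longleftrightarrow> (\<exists>f :: (nat + nat) \<times> nat \<Rightarrow> nat.
     proper_coloring G f \<and> f ` pverts G \<subseteq> {..<a})" for a
  have at: "alon_tarsi_number G = (LEAST a. P a)"
    and lc: "list_chromatic_number G = (LEAST a. Q a)"
    and ch: "chromatic_number G = (LEAST a. R a)"
    by (simp_all add: alon_tarsi_number_def list_chromatic_number_def chromatic_number_def
        P_def Q_def R_def)
  obtain a where "P a" "a \<le> m + 3"
    using ex_orientation_complete_join_cycle_path[OF L assms(3), of m] unfolding P_def G_def by blast
  then have P: "P (LEAST a. P a)" "(LEAST a. P a) \<le> m + 3"
    using LeastI[of P a] Least_le[of P a] by auto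
  have PQ: "Q a" if Pa: "P a" for a
  proof -
    obtain D where D: "orientation D G" "max_in_degree D + 1 = a"
      "card (even_circulations D) \<noteq> card (odd_circulations D)" using Pa unfolding P_def by blast
    show ?thesis unfolding Q_def using alon_tarsi[OF G D(1,3)] D(2) by blast
  qed
  \<comment> \<open>Giving every vertex the list \<open>{..<a}\<close> turns choosability into an
    ordinary colouring.\<close>
  have QR: "R a" if "Q a" for a
    using that[unfolded Q_def, rule_format, of "\<lambda>_. {..<a}"] by (auto simp: R_def)
  have "R a \<Longrightarrow> m + 3 \<le> a" for a
    unfolding R_def G_def using colors_complete_join_cycle_path[OF L assms(3)] by blast
  moreover have "Q (LEAST a. Q a)" "(LEAST a. Q a) \<le> (LEAST a. P a)"
    using PQ[OF P(1)] LeastI[of Q] Least_le[of Q] by auto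
  moreover have "R (LEAST a. R a)" "(LEAST a. R a) \<le> (LEAST a. Q a)"
    using QR[OF \<open>Q (LEAST a. Q a)\<close>] LeastI[of R] Least_le[of R] by auto
  ultimately have "(LEAST a. P a) = m + 3" "(LEAST a. Q a) = m + 3" "(LEAST a. R a) = m + 3"
    using P(2) by (meson le_antisym le_trans)+
  then have "alon_tarsi_number G = m + 3 \<and> chromatic_choosable G"
    unfolding chromatic_choosable_def at lc ch by simp
  then show ?thesis unfolding G_def .
qed

end
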